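(* Let $G$ be the graph on $7$ vertices whose complement is the disjoint union of a triangle $K_3$ and a $3$-star $K_{1,3}$. Then $G$ is connected and there is no CdV matrix for $G$ of corank $\mu(G)$ whose Perron--Frobenius eigenvector is the all-ones vector $\mathbb{1}$. In particular, it is not true that for every connected graph $H$ there exists a CdV matrix for $H$ of corank $\mu(H)$ with Perron--Frobenius eigenvector $\mathbb{1}$.
   Context: Graphs are finite, simple and undirected. For a graph $G=(V,E)$, $\mathcal{M}(G)$ denotes the set of all real symmetric matrices $M\in\mathbb{R}^{V\times V}$ such that (i) $M_{uv}<0$ whenever $uv\in E$, and $M_{uv}=0$ whenever $uv\notin E$ and $u\neq v$; (ii) $M$ has exactly one negative eigenvalue (counted with multiplicity). There is no condition on the diagonal of $M$. $\operatorname{corank}(M)=\dim\ker(M)$. A matrix $M\in\mathcal{M}(G)$ satisfies the Strong Arnold Property (SAP) if there is no non-zero symmetric matrix $X\in\mathbb{R}^{V\times V}$ such that $MX=\mathbf{0}$ and $X_{uv}=0$ whenever $uv\in E$ or $u=v$. Matrices $M\in\mathcal{M}(G)$ satisfying (SAP) are called CdV matrices for $G$, and $\mu(G)$ is the maximum corank of a CdV matrix for $G$. For connected $G$ and $M\in\mathcal{M}(G)$, the smallest eigenvalue of $M$ is simple and has an entrywise strictly positive eigenvector, unique up to positive scaling; it is called the Perron--Frobenius eigenvector of $M$ (so it "is $\mathbb{1}$" when $\mathbb{1}$ is an eigenvector for the smallest eigenvalue). Known fact, due to van der Holst, Lovász and Schrijver: the graph $G$ of the claim satisfies $\mu(G)=7-2=5$.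 *)

theory Defs
  imports
    "Graph_Theory.Graph_Theory"
    "Jordan_Normal_Form.Char_Poly"
    "Jordan_Normal_Form.Matrix_Kernel"
begin

text \<open>
  Simple undirected graphs are the loopless symmetric pair digraphs of \<^theory>\<open>Graph_Theory.Pair_Digraph\<close>:
  an edge \<open>uv\<close> is the pair of arcs \<open>(u,v)\<close>, \<open>(v,u)\<close>. A vertex set \<open>{0..<n}\<close> lets the matrices
  in \<open>\<real>\<^bsup>V\<times>V\<^esup>\<close> be the \<open>n \<times> n\<close> matrices of \<^theory>\<open>Jordan_Normal_Form.Matrix\<close>;
  every finite graph is isomorphic to one of this form.
\<close>

definition numbered_graph :: "nat \<Rightarrow> nat pair_pre_digraph \<Rightarrow> bool" where
  "numbered_graph n G \<longleftrightarrow> pair_graph G \<and> pverts G = {0..<n}"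

definition complement_graph :: "'a pair_pre_digraph \<Rightarrow> 'a pair_pre_digraph" where
  "complement_graph G =
     \<lparr> pverts = pverts G,
       parcs = {(u, v). u \<in> pverts G \<and> v \<in> pverts G \<and> u \<noteq> v \<and> (u, v) \<notin> parcs G} \<rparr>"

definition disjoint_union_of ::
  "('a, 'b) pre_digraph \<Rightarrow> ('a, 'b) pre_digraph \<Rightarrow> ('a, 'b) pre_digraph \<Rightarrow> bool" where
  "disjoint_union_of G A B \<longleftrightarrow> verts A \<inter> verts B = {} \<and> G = Digraph_Component.union A B"

text \<open>
  The multiplicity of an eigenvalue is its multiplicity as a root of the characteristic polynomial.
\<close>

definition num_neg_eigenvalues :: "real mat \<Rightarrow> nat" where
  "num_neg_eigenvalues M =
     (\<Sum>k | eigenvalue M k \<and> k < 0. Polynomial.order k (char_poly M))"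

definition graph_matrices :: "nat pair_pre_digraph \<Rightarrow> real mat set" where
  "graph_matrices G =
     {M. M \<in> carrier_mat (card (pverts G)) (card (pverts G))
       \<and> transpose_mat M = M
       \<and> (\<forall>u \<in> pverts G. \<forall>v \<in> pverts G. (u, v) \<in> parcs G \<longrightarrow> M $$ (u, v) < 0)
       \<and> (\<forall>u \<in> pverts G. \<forall>v \<in> pverts G. (u, v) \<notin> parcs G \<and> u \<noteq> v \<longrightarrow> M $$ (u, v) = 0)
       \<and> num_neg_eigenvalues M = 1}"

definition strong_arnold_property :: "nat pair_pre_digraph \<Rightarrow> real mat \<Rightarrow> bool" where
  "strong_arnold_property G M \<longleftrightarrow>
     (let n = card (pverts G) in
      \<not> (\<exists>X \<in> carrier_mat n n. X \<noteq> 0\<^sub>m n n \<and> transpose_mat X = X \<and> M * X = 0\<^sub>m n n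
           \<and> (\<forall>u \<in> pverts G. \<forall>v \<in> pverts G. (u, v) \<in> parcs G \<or> u = v \<longrightarrow> X $$ (u, v) = 0)))"

definition cdv_matrix :: "nat pair_pre_digraph \<Rightarrow> real mat \<Rightarrow> bool" where
  "cdv_matrix G M \<longleftrightarrow> M \<in> graph_matrices G \<and> strong_arnold_property G M"

abbreviation corank :: "real mat \<Rightarrow> nat" where
  "corank M \<equiv> kernel_dim M"

text \<open>
  \<open>Max\<close> is meaningful for \<open>n \<ge> 1\<close> vertices only: the graph without vertices has no CdV matrix.
  It is not connected in the sense of \<^const>\<open>connected\<close>, which requires a vertex.
\<close>

definition cdv_mu :: "nat pair_pre_digraph \<Rightarrow> nat" where
  "cdv_mu G = Max {corank M | M. cdv_matrix G M}"

definition perron_frobenius_eigenvector :: "real mat \<Rightarrow> real vec \<Rightarrow> bool" where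
  "perron_frobenius_eigenvector M v \<longleftrightarrow>
     (\<exists>l. eigenvector M v l \<and> (\<forall>k. eigenvalue M k \<longrightarrow> l \<le> k)) \<and> (\<forall>i < dim_vec v. v $ i > 0)"

definition all_ones :: "nat \<Rightarrow> real vec" where
  "all_ones n = vec n (\<lambda>_. 1)"

end

theory Submission
imports Defs "Jordan_Normal_Form.Jordan_Normal_Form_Uniqueness" "Jordan_Normal_Form.DL_Rank"
begin

text \<open>
  Let \<open>M\<close> be a matrix of the graph \<open>G\<close> of corank at least \<open>5\<close> on the seven vertices that has the
  all-ones vector as an eigenvector for its smallest eigenvalue \<open>l < 0\<close>. Then \<open>M\<close> has rank at most two,
  and after removal of the eigenvalue \<open>l\<close> there remains a symmetric matrix \<open>P = M - (l/7) J\<close>, with \<open>J\<close>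
  the all-ones matrix, of rank at most one and with zero row sums. At every nonedge of \<open>G\<close> its entry is
  \<open>s = - l/7 > 0\<close>. As \<open>P\<close> has the form \<open>\<plusminus>w w\<^sup>T\<close>, the triangle in the complement makes \<open>w\<close> constant on
  the triangle and the sign positive, and the star makes \<open>w\<close> constant on the leaves, the product of
  this value with the value at the centre being \<open>s\<close>. In units where \<open>s = 1\<close> and \<open>w = 1\<close> on the
  triangle, \<open>w\<close> is some \<open>t\<close> on the leaves and \<open>1/t\<close> at the centre, and the row sums give
  \<open>3 + 3 t + 1/t = 0\<close>, that is \<open>3 t\<^sup>2 + 3 t + 1 = 0\<close>, which has no real solution. This is
  \<open>no_all_ones_eigenvector\<close>, with the rank-one property supplied by \<open>deflated_minor_zero\<close>.

  It remains to see that \<open>\<mu>(G) \<ge> 5\<close>, so that an optimal matrix does have corank at least \<open>5\<close>. If the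
  eigenvector of the negative eigenvalue need not be constant, the same pattern can be realised:
  \<open>base_matrix\<close> is an explicit rank-two matrix, an explicit eigenbasis shows that its nonzero
  eigenvalues are \<open>-5\<close> and \<open>3\<close>, and \<open>witness_sap\<close> verifies the Strong Arnold Property.
\<close>

section \<open>Coranks of square matrices\<close>

lemma wide_matrix_kernel:
  fixes A :: "'a :: field mat"
  assumes A: "A \<in> carrier_mat n m" and "n < m"
  obtains v where "v \<in> carrier_vec m" "v \<noteq> 0\<^sub>v m" "A *\<^sub>v v = 0\<^sub>v n"
proof -
  \<comment> \<open>Zero rows make the matrix square without changing its kernel.\<close>
  define S where "S = mat m m (\<lambda>(i, j). if i < n then A $$ (i, j) else 0)"
  have S: "S \<in> carrier_mat m m"
    by (simp add: S_def)
  have "S = mat\<^sub>r m m (\<lambda>i. if i = n then 0\<^sub>v m else row S i)"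
    using \<open>n < m\<close> by (intro eq_matI) (auto simp: S_def mat_of_rows_def)
  also have "det \<dots> = 0"
    using \<open>n < m\<close> S by (intro det_row_0) auto
  finally have "det S = 0" .
  then obtain v where v: "v \<in> carrier_vec m" "v \<noteq> 0\<^sub>v m" "S *\<^sub>v v = 0\<^sub>v m"
    using det_0_iff_vec_prod_zero_field[OF S] by blast
  have "A *\<^sub>v v = 0\<^sub>v n"
  proof (rule eq_vecI)
    fix i assume "i < dim_vec (0\<^sub>v n :: 'a vec)"
    hence i: "i < n" by simp
    hence "row S i = row A i"
      using A \<open>n < m\<close> by (intro eq_vecI) (auto simp: S_def)
    moreover have "(S *\<^sub>v v) $ i = 0"
      using v i \<open>n < m\<close> by simp
    ultimately show "(A *\<^sub>v v) $ i = 0\<^sub>v n $ i"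
      using i \<open>n < m\<close> A S by simp
  qed (use A in auto)
  with v that show thesis by blast
qed

text \<open>
  A basis of the kernel, arranged as the columns of a matrix, turns the dimension of the kernel into
  the number of columns of an injective matrix. In this form it can be put next to other columns.
\<close>

lemma kernel_basis_matrix:
  fixes M :: "'a :: field mat"
  assumes M: "M \<in> carrier_mat n n"
  obtains K where "K \<in> carrier_mat n (kernel_dim M)"
    "\<And>c. c \<in> carrier_vec (kernel_dim M) \<Longrightarrow> M *\<^sub>v (K *\<^sub>v c) = 0\<^sub>v n"
    "\<And>c. c \<in> carrier_vec (kernel_dim M) \<Longrightarrow> K *\<^sub>v c = 0\<^sub>v n \<Longrightarrow> c = 0\<^sub>v (kernel_dim M)"
proof -
  interpret kernel n n M by unfold_locales (rule M)
  obtain B where B: "finite B" "basis B"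
    using kernel_basis_exists[OF M] by blast
  hence Bk: "B \<subseteq> mat_kernel M" and "Ker.lin_indpt B"
    by (auto simp: Ker.basis_def)
  hence li: "NC.lin_indpt B"
    using lindep_same by blast
  have card: "card B = kernel_dim M"
    using B Ker.dim_basis by simp
  obtain ks where ks: "set ks = B" "distinct ks"
    using finite_distinct_list[OF B(1)] by blast
  have len: "length ks = kernel_dim M"
    using card ks distinct_card by fastforce
  have ksc: "set ks \<subseteq> carrier_vec n"
    using ks Bk mat_kernel_carrier[OF M] by auto
  define K where "K = mat_of_cols n ks"
  have K: "K \<in> carrier_mat n (kernel_dim M)"
    using len unfolding K_def by (metis mat_of_cols_carrier(1))
  have cols: "cols K = ks"
    unfolding K_def using ksc by (rule cols_mat_of_cols)
  have MK: "M * K = 0\<^sub>m n (kernel_dim M)"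
  proof (rule eq_matI)
    fix i j assume "i < dim_row (0\<^sub>m n (kernel_dim M) :: 'a mat)" "j < dim_col (0\<^sub>m n (kernel_dim M) :: 'a mat)"
    hence ij: "i < n" "j < kernel_dim M" by auto
    have "col K j = ks ! j"
      using ij K cols by (metis carrier_matD(2) cols_nth)
    hence "col K j \<in> mat_kernel M"
      using ij len ks Bk by (metis nth_mem subsetD)
    hence "M *\<^sub>v col K j = 0\<^sub>v n"
      using mat_kernelD[OF M] by blast
    hence "(M *\<^sub>v col K j) $ i = 0"
      using ij by simp
    thus "(M * K) $$ (i, j) = 0\<^sub>m n (kernel_dim M) $$ (i, j)"
      using ij M K by simp
  qed (use M K in auto)
  show thesis
  proof (rule that[OF K])
    fix c :: "'a vec" assume c: "c \<in> carrier_vec (kernel_dim M)"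
    have "M *\<^sub>v (K *\<^sub>v c) = (M * K) *\<^sub>v c"
      using M K c by (simp add: assoc_mult_mat_vec)
    also have "\<dots> = 0\<^sub>v n"
      unfolding MK using c by (intro eq_vecI) auto
    finally show "M *\<^sub>v (K *\<^sub>v c) = 0\<^sub>v n" .
  next
    fix c :: "'a vec" assume c: "c \<in> carrier_vec (kernel_dim M)" "K *\<^sub>v c = 0\<^sub>v n"
    show "c = 0\<^sub>v (kernel_dim M)"
      using NC.lin_depI[OF K c(1) _ c(2)] cols ks li by auto
  qed
qed

text \<open>
  The columns of a kernel basis \<open>K\<close> together with those of \<open>F\<close> are too many to be independent, so
  \<open>K a + F c = 0\<close> for some \<open>(a, c) \<noteq> 0\<close>. Since \<open>K\<close> is injective, \<open>c\<close> cannot vanish, and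
  \<open>F c = - K a\<close> lies in the kernel.
\<close>

lemma kernel_meets_image:
  fixes M F :: "'a :: field mat"
  assumes M: "M \<in> carrier_mat n n" and F: "F \<in> carrier_mat n k"
    and large: "n < kernel_dim M + k"
  obtains c where "c \<in> carrier_vec k" "c \<noteq> 0\<^sub>v k" "M *\<^sub>v (F *\<^sub>v c) = 0\<^sub>v n"
proof -
  let ?d = "kernel_dim M"
  obtain K where K: "K \<in> carrier_mat n ?d"
    and MK: "\<And>c. c \<in> carrier_vec ?d \<Longrightarrow> M *\<^sub>v (K *\<^sub>v c) = 0\<^sub>v n"
    and inj: "\<And>c. c \<in> carrier_vec ?d \<Longrightarrow> K *\<^sub>v c = 0\<^sub>v n \<Longrightarrow> c = 0\<^sub>v ?d"
    using kernel_basis_matrix[OF M] by blast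
  \<comment> \<open>The lower blocks have no rows: this is just the horizontal concatenation of \<open>K\<close> and \<open>F\<close>.\<close>
  define B where "B = four_block_mat K F (0\<^sub>m 0 ?d) (0\<^sub>m 0 k)"
  have "B \<in> carrier_mat n (?d + k)"
    using carrier_matD[OF K] carrier_matD[OF F] unfolding B_def by (intro carrier_matI) simp_all
  then obtain v where v: "v \<in> carrier_vec (?d + k)" "v \<noteq> 0\<^sub>v (?d + k)" "B *\<^sub>v v = 0\<^sub>v n"
    using large by (rule wide_matrix_kernel)
  define a c where "a = vec_first v ?d" and "c = vec_last v k"
  have a: "a \<in> carrier_vec ?d" and c: "c \<in> carrier_vec k" and vac: "v = a @\<^sub>v c"
    using v(1) by (simp_all add: a_def c_def)
  have Bv: "B *\<^sub>v v = (K *\<^sub>v a + F *\<^sub>v c) @\<^sub>v (0\<^sub>m 0 ?d *\<^sub>v a + 0\<^sub>m 0 k *\<^sub>v c)"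
    unfolding B_def vac by (rule four_block_mat_mult_vec[OF K F zero_carrier_mat zero_carrier_mat a c])
  have sum0: "K *\<^sub>v a + F *\<^sub>v c = 0\<^sub>v n"
  proof (rule eq_vecI)
    fix i assume "i < dim_vec (0\<^sub>v n :: 'a vec)"
    hence i: "i < n" by simp
    have "(B *\<^sub>v v) $ i = 0" using v(3) i by simp
    thus "(K *\<^sub>v a + F *\<^sub>v c) $ i = 0\<^sub>v n $ i"
      using i carrier_matD[OF F] unfolding Bv by simp
  qed (use carrier_matD[OF F] in simp)
  have Ka: "K *\<^sub>v a \<in> carrier_vec n" and Fc: "F *\<^sub>v c \<in> carrier_vec n"
    using K F a c by simp_all
  show thesis
  proof (rule that[OF c])
    show "c \<noteq> 0\<^sub>v k"
    proof
      assume c0: "c = 0\<^sub>v k"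
      hence "F *\<^sub>v c = 0\<^sub>v n"
        using F by (intro eq_vecI) simp_all
      hence "K *\<^sub>v a = 0\<^sub>v n"
        using sum0 Ka by simp
      hence "a = 0\<^sub>v ?d"
        by (rule inj[OF a])
      hence "v = 0\<^sub>v (?d + k)"
        unfolding vac c0 by (intro eq_vecI) simp_all
      with v(2) show False ..
    qed
    have "0\<^sub>v n = M *\<^sub>v (K *\<^sub>v a + F *\<^sub>v c)"
      unfolding sum0 using M by (intro eq_vecI) simp_all
    also have "\<dots> = M *\<^sub>v (K *\<^sub>v a) + M *\<^sub>v (F *\<^sub>v c)"
      by (rule mult_add_distrib_mat_vec[OF M Ka Fc])
    also have "\<dots> = M *\<^sub>v (F *\<^sub>v c)"
      using MK[OF a] M Fc by simp
    finally show "M *\<^sub>v (F *\<^sub>v c) = 0\<^sub>v n" ..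
  qed
qed

lemma kernel_dim_le:
  assumes "M \<in> carrier_mat n m"
  shows "kernel_dim M \<le> m"
  using assms by (simp add: kernel_dim_code)

text \<open>
  Deflation: subtracting \<open>l / n\<close> from every entry removes the eigenvalue \<open>l\<close> of the all-ones vector
  and leaves a matrix of rank at most one, whose \<open>2 \<times> 2\<close> minors therefore vanish. The
  kernel of \<open>M\<close> contains a nontrivial combination of the two unit vectors
  \<open>e\<^sub>k\<close>, \<open>e\<^sub>m\<close> and the all-ones vector, because the corank is at least \<open>n - 2\<close>. Summing the entries
  of the resulting relation determines the coefficient of the all-ones vector, and what remains is a
  linear dependence between columns \<open>k\<close> and \<open>m\<close> of the deflated matrix.
\<close>

lemma deflated_minor_zero:
  fixes M :: "real mat"
  assumes M: "M \<in> carrier_mat n n" and sym: "transpose_mat M = M"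
    and eig: "M *\<^sub>v all_ones n = l \<cdot>\<^sub>v all_ones n" and "l \<noteq> 0"
    and large: "n \<le> kernel_dim M + 2"
    and "i < n" "j < n" "k < n" "m < n"
  shows "(M $$ (i, k) - l / n) * (M $$ (j, m) - l / n) = (M $$ (i, m) - l / n) * (M $$ (j, k) - l / n)"
proof -
  have M_sym: "M $$ (a, b) = M $$ (b, a)" if "a < n" "b < n" for a b
    using sym M that by (metis carrier_matD index_transpose_mat(1))
  have row_sum: "(\<Sum>b\<in>{0..<n}. M $$ (a, b)) = l" if "a < n" for a
  proof -
    have "(M *\<^sub>v all_ones n) $ a = l"
      unfolding eig using that by (simp add: all_ones_def)
    thus ?thesis
      using that M by (simp add: all_ones_def scalar_prod_def)
  qed
  have col_sum: "(\<Sum>a\<in>{0..<n}. M $$ (a, b)) = l" if "b < n" for b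
  proof -
    have "(\<Sum>a\<in>{0..<n}. M $$ (a, b)) = (\<Sum>a\<in>{0..<n}. M $$ (b, a))"
      using that by (intro sum.cong refl M_sym) auto
    thus ?thesis
      using row_sum[OF that] by simp
  qed
  \<comment> \<open>The columns are \<open>e\<^sub>k\<close>, \<open>e\<^sub>m\<close> and the all-ones vector.\<close>
  define F where
    "F = mat n 3 (\<lambda>(r, c). if c = 0 then of_bool (r = k) else if c = 1 then of_bool (r = m) else (1 :: real))"
  have F: "F \<in> carrier_mat n 3"
    by (simp add: F_def)
  obtain c where c: "c \<in> carrier_vec 3" "c \<noteq> 0\<^sub>v 3" "M *\<^sub>v (F *\<^sub>v c) = 0\<^sub>v n"
    using kernel_meets_image[OF M F] large by auto
  have Fc: "(F *\<^sub>v c) $ r = of_bool (r = k) * c $ 0 + of_bool (r = m) * c $ 1 + c $ 2" if "r < n" for r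
    using that c(1) by (simp add: F_def scalar_prod_def eval_nat_numeral)
  have comb: "c $ 0 * M $$ (a, k) + c $ 1 * M $$ (a, m) + c $ 2 * l = 0" if "a < n" for a
  proof -
    have "0 = (M *\<^sub>v (F *\<^sub>v c)) $ a"
      using c(3) that by simp
    also have "\<dots> = (\<Sum>r\<in>{0..<n}. M $$ (a, r) * (F *\<^sub>v c) $ r)"
      using that M F by (simp add: scalar_prod_def)
    also have "\<dots> = (\<Sum>r\<in>{0..<n}. (if r = k then c $ 0 * M $$ (a, k) else 0)
                      + (if r = m then c $ 1 * M $$ (a, m) else 0) + c $ 2 * M $$ (a, r))"
      by (intro sum.cong refl) (simp add: Fc algebra_simps)
    also have "\<dots> = c $ 0 * M $$ (a, k) + c $ 1 * M $$ (a, m) + c $ 2 * l"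
      using \<open>k < n\<close> \<open>m < n\<close> row_sum[OF that]
      by (simp add: sum.distrib flip: sum_distrib_left)
    finally show ?thesis by simp
  qed
  have "0 = (\<Sum>a\<in>{0..<n}. c $ 0 * M $$ (a, k) + c $ 1 * M $$ (a, m) + c $ 2 * l)"
    using comb by simp
  also have "\<dots> = l * (c $ 0 + c $ 1 + n * c $ 2)"
    using col_sum \<open>k < n\<close> \<open>m < n\<close>
    by (simp add: sum.distrib algebra_simps flip: sum_distrib_left)
  finally have "c $ 0 + c $ 1 + n * c $ 2 = 0"
    using \<open>l \<noteq> 0\<close> by simp
  hence c2: "c $ 2 = - (c $ 0 + c $ 1) / n"
    using \<open>i < n\<close> by (simp add: field_simps)
  have nz: "c $ 0 \<noteq> 0 \<or> c $ 1 \<noteq> 0"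
  proof (rule ccontr)
    assume "\<not> ?thesis"
    with c2 have "c = 0\<^sub>v 3"
      using c(1) by (intro eq_vecI) (auto simp: less_Suc_eq eval_nat_numeral)
    with c(2) show False ..
  qed
  have dep: "c $ 0 * (M $$ (a, k) - l / n) + c $ 1 * (M $$ (a, m) - l / n) = 0" if "a < n" for a
    using comb[OF that] unfolding c2 by (simp add: algebra_simps add_divide_distrib diff_divide_distrib)
  define x y z w where "x = M $$ (i, k) - l / n" and "y = M $$ (j, m) - l / n"
    and "z = M $$ (i, m) - l / n" and "w = M $$ (j, k) - l / n"
  have e: "c $ 0 * x + c $ 1 * z = 0" "c $ 0 * w + c $ 1 * y = 0"
    using dep \<open>i < n\<close> \<open>j < n\<close> by (auto simp: x_def y_def z_def w_def)
  have "c $ 0 * (x * y - z * w) = y * (c $ 0 * x + c $ 1 * z) - z * (c $ 0 * w + c $ 1 * y)"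
       "c $ 1 * (x * y - z * w) = x * (c $ 0 * w + c $ 1 * y) - w * (c $ 0 * x + c $ 1 * z)"
    by (simp_all add: algebra_simps)
  hence "x * y = z * w"
    using e nz by auto
  thus ?thesis
    by (simp add: x_def y_def z_def w_def)
qed

lemma similar_mat_reindex:
  fixes A :: "'a :: field mat"
  assumes A: "A \<in> carrier_mat n n" and p: "bij_betw p {0..<n} {0..<n}"
  shows "similar_mat (mat n n (\<lambda>(i, j). A $$ (p i, p j))) A"
proof -
  define P where "P = mat n n (\<lambda>(i, j). if p i = j then 1 else 0 :: 'a)"
  define Q where "Q = mat n n (\<lambda>(i, j). if p j = i then 1 else 0 :: 'a)"
  have PQ_carrier: "P \<in> carrier_mat n n" "Q \<in> carrier_mat n n"
    by (simp_all add: P_def Q_def)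
  have p_less: "p i < n" if "i < n" for i
    using bij_betwE[OF p] that by auto
  have p_inj: "p i = p j \<longleftrightarrow> i = j" if "i < n" "j < n" for i j
    using bij_betw_imp_inj_on[OF p] that by (auto dest: inj_onD)
  have P_mult: "P * B = mat n n (\<lambda>(i, j). B $$ (p i, j))" if "B \<in> carrier_mat n n" for B
    using that by (intro eq_matI) (auto simp: P_def scalar_prod_def p_less if_distrib[of "\<lambda>x. x * y" for y] cong: if_cong)
  have PQ: "P * Q = 1\<^sub>m n"
    unfolding P_mult[OF PQ_carrier(2)] by (intro eq_matI) (auto simp: Q_def p_less p_inj)
  have "P * A * Q = mat n n (\<lambda>(i, j). A $$ (p i, p j))"
    unfolding P_mult[OF A] by (intro eq_matI) (auto simp: Q_def scalar_prod_def p_less if_distrib[of "\<lambda>x. y * x" for y] cong: if_cong)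
  with PQ PQ_carrier A show ?thesis
    by (intro similar_matI[of _ _ P Q n] mat_mult_left_right_inverse[of P n Q]) auto
qed

lemma jordan_matrix_diagonal:
  assumes "i < length xs" "j < length xs"
  shows "jordan_matrix (map (Pair 1) xs) $$ (i, j) = (if i = j then xs ! i else (0 :: 'a :: {zero, one}))"
  using assms
proof (induction xs arbitrary: i j)
  case (Cons x xs)
  have dim: "dim_row (jordan_matrix (map (Pair (Suc 0)) xs)) = length xs"
    "dim_col (jordan_matrix (map (Pair (Suc 0)) xs)) = length xs"
    by (simp_all add: o_def sum_list_triv)
  show ?case
    using Cons dim by (auto simp: jordan_matrix_def Let_def jordan_block_def nth_Cons split: nat.splits)
qed simp

section \<open>A matrix of corank five with one negative eigenvalue\<close>

text \<open>
  Throughout, the vertices are referred to by their positions: \<open>0, 1, 2\<close> form the triangle of the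
  complement, \<open>3\<close> is the centre of the star and \<open>4, 5, 6\<close> are its leaves.

  If \<open>u > 0\<close> and \<open>w \<noteq> 0\<close> are orthogonal, then \<open>w w\<^sup>T - u u\<^sup>T\<close> has the single negative eigenvalue \<open>-\<bar>u\<bar>\<^sup>2\<close>, the
  single positive eigenvalue \<open>\<bar>w\<bar>\<^sup>2\<close>, and corank \<open>n - 2\<close>. The entry at \<open>(i, j)\<close> vanishes iff the
  ratios \<open>r = w / u\<close> satisfy \<open>r i * r j = 1\<close>, and it is negative iff \<open>r i * r j < 1\<close>. The choice
  \<open>r = 1\<close> on the triangle, \<open>r = -3\<close> at the centre and \<open>r = -1/3\<close> on the leaves gives the required
  pattern. The entries \<open>2, 1, 3\<close> of \<open>u\<close> make \<open>u\<close> and \<open>w\<close> orthogonal, and the factor \<open>1/8\<close> makes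
  every entry at an edge equal to \<open>-1\<close>. The squared norms are \<open>40\<close> and \<open>24\<close>, so the two nonzero
  eigenvalues are \<open>-5\<close> and \<open>3\<close>.
\<close>

definition neg_eigvec :: "nat \<Rightarrow> real" where
  "neg_eigvec i = (if i < 3 then 2 else if i = 3 then 1 else 3)"

definition pos_eigvec :: "nat \<Rightarrow> real" where
  "pos_eigvec i = (if i < 3 then 2 else if i = 3 then -3 else -1)"

text \<open>
  The vector orthogonal to the two previous ones among those that are constant on the triangle and on
  the leaves. The rest of the kernel consists of the vectors that are supported on the triangle or on
  the leaves and have entries summing to zero.
\<close>

definition null_eigvec :: "nat \<Rightarrow> real" where
  "null_eigvec i = (if i < 3 then 1 else if i = 3 then 3 else -1)"

definition base_matrix :: "real mat" where
  "base_matrix = mat 7 7 (\<lambda>(i, j). (pos_eigvec i * pos_eigvec j - neg_eigvec i * neg_eigvec j) / 8)"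

lemma base_matrix_carrier: "base_matrix \<in> carrier_mat 7 7"
  by (simp add: base_matrix_def)

definition eigenbasis :: "real mat" where
  "eigenbasis = mat 7 7 (\<lambda>(i, k).
     [neg_eigvec i, pos_eigvec i, null_eigvec i,
      of_bool (i = 0) - of_bool (i = 1), of_bool (i = 1) - of_bool (i = 2),
      of_bool (i = 4) - of_bool (i = 5), of_bool (i = 5) - of_bool (i = 6)] ! k)"

text \<open>
  The first three columns of the eigenbasis are orthogonal to all other columns, so the first three
  rows of the inverse are these columns divided by their squared norms \<open>40\<close>, \<open>24\<close>, \<open>15\<close>. The remaining
  rows are dual to the differences of consecutive unit vectors, within the vectors on the triangle and
  on the leaves whose entries sum to zero.
\<close>

definition eigenbasis_inverse :: "real mat" where
  "eigenbasis_inverse = mat 7 7 (\<lambda>(k, j).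
     [neg_eigvec j / 40, pos_eigvec j / 24, null_eigvec j / 15,
      of_bool (j = 0) - of_bool (j < 3) / 3, of_bool (j < 3) / 3 - of_bool (j = 2),
      of_bool (j = 4) - of_bool (3 < j) / 3, of_bool (3 < j) / 3 - of_bool (j = 6)] ! k)"

lemma less_7_cases: "i < (7 :: nat) \<longleftrightarrow> i = 0 \<or> i = 1 \<or> i = 2 \<or> i = 3 \<or> i = 4 \<or> i = 5 \<or> i = 6"
  by auto

lemma sum_less_7: "(\<Sum>i\<in>{0..<7 :: nat}. f i) = f 0 + f 1 + f 2 + f 3 + f 4 + f 5 + (f 6 :: 'a :: comm_monoid_add)"
  by (simp add: eval_nat_numeral add.assoc)

text \<open>
  An explicit diagonalisation is recorded as a Jordan normal form with blocks of size one because both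
  quantities needed below, the order of a root of the characteristic polynomial and the dimension of
  the kernel, can be read off from a Jordan normal form.
\<close>

lemma jordan_nf_of_eigenbasis:
  fixes A P Q :: "'a :: field mat"
  assumes A: "A \<in> carrier_mat n n" and P: "P \<in> carrier_mat n n" and Q: "Q \<in> carrier_mat n n"
    and PQ: "P * Q = 1\<^sub>m n" and len: "length es = n"
    and A_eq: "\<And>i j. i < n \<Longrightarrow> j < n \<Longrightarrow> A $$ (i, j) = (\<Sum>k\<in>{0..<n}. P $$ (i, k) * es ! k * Q $$ (k, j))"
  shows "jordan_nf A (map (Pair 1) es)"
proof -
  define D where "D = jordan_matrix (map (Pair 1) es)"
  have D: "D \<in> carrier_mat n n"
    using jordan_matrix_carrier[of "map (Pair 1) es"] len by (simp add: D_def o_def sum_list_triv)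
  have PD: "P * D = mat n n (\<lambda>(i, k). P $$ (i, k) * es ! k)"
  proof (rule eq_matI)
    fix i k assume "i < dim_row (mat n n (\<lambda>(i, k). P $$ (i, k) * es ! k))"
      "k < dim_col (mat n n (\<lambda>(i, k). P $$ (i, k) * es ! k))"
    hence ik: "i < n" "k < n" by simp_all
    have "(P * D) $$ (i, k) = (\<Sum>r\<in>{0..<n}. P $$ (i, r) * D $$ (r, k))"
      using ik P D by (simp add: scalar_prod_def)
    also have "\<dots> = (\<Sum>r\<in>{0..<n}. if r = k then P $$ (i, k) * es ! k else 0)"
      unfolding D_def using ik len by (intro sum.cong refl) (simp add: jordan_matrix_diagonal del: One_nat_def)
    finally show "(P * D) $$ (i, k) = mat n n (\<lambda>(i, k). P $$ (i, k) * es ! k) $$ (i, k)"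
      using ik by simp
  qed (use P D in auto)
  have "A = P * D * Q"
    unfolding PD using A Q by (intro eq_matI) (simp_all add: A_eq scalar_prod_def)
  hence "similar_mat A D"
    using A P Q D PQ mat_mult_left_right_inverse[OF P Q PQ] by (intro similar_matI[of _ _ P Q n]) auto
  thus ?thesis
    by (auto simp: jordan_nf_def D_def)
qed

lemma base_matrix_jordan_nf:
  "jordan_nf base_matrix (map (Pair 1) [-5, 3, 0, 0, 0, 0, 0])"
proof (rule jordan_nf_of_eigenbasis)
  show carrier: "base_matrix \<in> carrier_mat 7 7" "eigenbasis \<in> carrier_mat 7 7"
    "eigenbasis_inverse \<in> carrier_mat 7 7"
    by (simp_all add: base_matrix_def eigenbasis_def eigenbasis_inverse_def)
  show "eigenbasis * eigenbasis_inverse = 1\<^sub>m 7"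
  proof (rule eq_matI)
    fix i j assume "i < dim_row (1\<^sub>m 7 :: real mat)" "j < dim_col (1\<^sub>m 7 :: real mat)"
    hence ij: "i < 7" "j < 7" by simp_all
    hence "(eigenbasis * eigenbasis_inverse) $$ (i, j)
        = (\<Sum>k\<in>{0..<7}. eigenbasis $$ (i, k) * eigenbasis_inverse $$ (k, j))"
      using carrier by (simp add: scalar_prod_def)
    also have "\<dots> = 1\<^sub>m 7 $$ (i, j)"
      using ij unfolding less_7_cases
      by (elim disjE; simp add: sum_less_7 eigenbasis_def eigenbasis_inverse_def
          neg_eigvec_def pos_eigvec_def null_eigvec_def)
    finally show "(eigenbasis * eigenbasis_inverse) $$ (i, j) = 1\<^sub>m 7 $$ (i, j)" .
  qed (use carrier in auto)
  fix i j :: nat assume "i < 7" "j < 7"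
  thus "base_matrix $$ (i, j)
      = (\<Sum>k\<in>{0..<7}. eigenbasis $$ (i, k) * [-5, 3, 0, 0, 0, 0, 0] ! k * eigenbasis_inverse $$ (k, j))"
    by (simp add: sum_less_7 base_matrix_def eigenbasis_def eigenbasis_inverse_def)
qed simp

text \<open>Adjacency of positions in the disjoint union of a triangle and a 3-star.\<close>

definition coadjacent :: "nat \<Rightarrow> nat \<Rightarrow> bool" where
  "coadjacent i j \<longleftrightarrow> i \<noteq> j \<and> (i < 3 \<and> j < 3 \<or> i = 3 \<and> 3 < j \<or> 3 < i \<and> j = 3)"

lemma base_matrix_entry:
  assumes "i < 7" "j < 7" "i \<noteq> j"
  shows "base_matrix $$ (i, j) = (if coadjacent i j then 0 else -1)"
  using assms by (auto simp: base_matrix_def coadjacent_def pos_eigvec_def neg_eigvec_def)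

lemma char_matrix_zero: "A \<in> carrier_mat n n \<Longrightarrow> char_matrix A (0 :: 'a :: field) = A"
  by (intro eq_matI) (auto simp: char_matrix_def)

lemma base_matrix_spectrum:
  assumes A: "A \<in> carrier_mat 7 7" and jnf: "jordan_nf A (map (Pair 1) [-5, 3, 0, 0, 0, 0, 0])"
  shows "num_neg_eigenvalues A = 1" and "kernel_dim A = 5"
proof -
  have order: "Polynomial.order k (char_poly A) = (if k = 0 then 5 else if k = -5 \<or> k = 3 then 1 else 0)" for k
    unfolding jordan_nf_order[OF jnf] by auto
  have "char_poly A \<noteq> 0"
    using degree_monic_char_poly[OF A] by auto
  hence "eigenvalue A k \<longleftrightarrow> Polynomial.order k (char_poly A) \<noteq> 0" for k
    using eigenvalue_root_char_poly[OF A] order_root by auto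
  hence "{k. eigenvalue A k \<and> k < 0} = {-5}"
    by (auto simp: order split: if_splits)
  thus "num_neg_eigenvalues A = 1"
    by (simp add: num_neg_eigenvalues_def order)
  have "kernel_dim A = dim_gen_eigenspace A 0 1"
    using A by (simp add: dim_gen_eigenspace_def char_matrix_zero)
  also have "\<dots> = 5"
    unfolding dim_gen_eigenspace[OF jnf] by simp
  finally show "kernel_dim A = 5" .
qed
section \<open>The complement of a triangle and a 3-star\<close>

text \<open>
  The function \<open>x\<close> maps positions to the actual vertices of the graph.
\<close>

locale triangle_star_complement =
  fixes G :: "nat pair_pre_digraph" and x :: "nat \<Rightarrow> nat"
  assumes graph: "numbered_graph 7 G"
    and x_bij: "bij_betw x {0..<7} {0..<7}"
    and arc_iff: "\<And>i j. i < 7 \<Longrightarrow> j < 7 \<Longrightarrow> (x i, x j) \<in> parcs G \<longleftrightarrow> i \<noteq> j \<and> \<not> coadjacent i j"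
begin

lemma pverts_G: "pverts G = {0..<7}"
  using graph by (simp add: numbered_graph_def)

lemma x_less: "i < 7 \<Longrightarrow> x i < 7"
  using bij_betwE[OF x_bij] by auto

lemma x_eq_iff: "i < 7 \<Longrightarrow> j < 7 \<Longrightarrow> x i = x j \<longleftrightarrow> i = j"
  using bij_betw_imp_inj_on[OF x_bij] by (auto dest: inj_onD)

definition position :: "nat \<Rightarrow> nat" where
  "position = inv_into {0..<7} x"

lemma position_bij: "bij_betw position {0..<7} {0..<7}"
  unfolding position_def by (rule bij_betw_inv_into[OF x_bij])

lemma position_less: "u < 7 \<Longrightarrow> position u < 7"
  using bij_betwE[OF position_bij] by auto

lemma x_position: "u < 7 \<Longrightarrow> x (position u) = u"
  unfolding position_def using bij_betw_inv_into_right[OF x_bij] by simp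

lemma position_x: "i < 7 \<Longrightarrow> position (x i) = i"
  unfolding position_def using bij_betw_inv_into_left[OF x_bij] by simp

lemma arc_position:
  assumes "u < 7" "v < 7"
  shows "(u, v) \<in> parcs G \<longleftrightarrow> u \<noteq> v \<and> \<not> coadjacent (position u) (position v)"
  using arc_iff[of "position u" "position v"] assms
  by (metis position_less x_position)

text \<open>The diameter is two: positions in the triangle are joined through a leaf, all other pairs of
  nonadjacent positions through the triangle.\<close>

lemma connected_G: "connected (with_proj G)"
proof -
  interpret pair_graph G
    using graph by (simp add: numbered_graph_def)
  have reach: "x i \<rightarrow>\<^sup>*\<^bsub>with_proj G\<^esub> x j" if "i < 7" "j < 7" for i j
  proof -
    have adj: "(x k, x m) \<in> parcs G" if "k < 7" "m < 7" "k \<noteq> m" "\<not> coadjacent k m" for k m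
      using that arc_iff by simp
    consider "i = j" | "i \<noteq> j" "\<not> coadjacent i j" | "coadjacent i j" by blast
    thus ?thesis
    proof cases
      case 1
      thus ?thesis using that x_less pverts_G by auto
    next
      case 2
      show ?thesis
        by (rule reachable_adjI[OF adj[OF that 2]])
    next
      case 3
      define k :: nat where "k = (if i < 3 then 4 else 0)"
      have "k < 7" "i \<noteq> k" "k \<noteq> j" "\<not> coadjacent i k" "\<not> coadjacent k j"
        using 3 by (auto simp: coadjacent_def k_def)
      hence "(x i, x k) \<in> parcs G" "(x k, x j) \<in> parcs G"
        using that by (simp_all add: adj)
      thus ?thesis
        by (meson reachable_adjI reachable_trans)
    qed
  qed
  show ?thesis
    unfolding connected_def
  proof (rule strongly_connectedI)
    show "verts (with_proj (mk_symmetric (with_proj G))) \<noteq> {}"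
      by (simp add: pverts_G)
  next
    fix u v assume "u \<in> verts (with_proj (mk_symmetric (with_proj G)))" "v \<in> verts (with_proj (mk_symmetric (with_proj G)))"
    hence uv: "u < 7" "v < 7" by (simp_all add: pverts_G)
    have "u \<rightarrow>\<^sup>*\<^bsub>with_proj G\<^esub> v"
      using reach[of "position u" "position v"] uv by (simp add: position_less x_position)
    thus "u \<rightarrow>\<^sup>*\<^bsub>with_proj (mk_symmetric (with_proj G))\<^esub> v"
      by (rule reachable_mk_symmetricI)
  qed
qed

text \<open>
  The deflated matrix \<open>P\<close> has rank at most one and the constant value \<open>s = - l / 7\<close> at all nonedges.
  The triangle forces \<open>P = s\<close> on its diagonal as well, and the star forces \<open>P\<close> to take one value \<open>p\<close> at
  all pairs of a triangle position and a leaf. With \<open>q\<close> the value at a triangle position and the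
  centre, the minors give \<open>p * q = s\<^sup>2\<close>, while the row sum gives \<open>3 s + q + 3 p = 0\<close>. Eliminating \<open>q\<close>
  leaves \<open>3 p\<^sup>2 + 3 p s + s\<^sup>2 = 0\<close>, a quadratic form of negative discriminant at \<open>s \<noteq> 0\<close>.
\<close>

lemma no_all_ones_eigenvector:
  assumes M: "M \<in> graph_matrices G" and eig: "M *\<^sub>v all_ones 7 = l \<cdot>\<^sub>v all_ones 7" and "l < 0"
  shows "kernel_dim M < 5"
proof (rule ccontr)
  assume "\<not> kernel_dim M < 5"
  hence large: "7 \<le> kernel_dim M + 2" by simp
  have carrier: "M \<in> carrier_mat 7 7" and sym: "transpose_mat M = M"
    and nonadj: "\<And>u v. u < 7 \<Longrightarrow> v < 7 \<Longrightarrow> (u, v) \<notin> parcs G \<Longrightarrow> u \<noteq> v \<Longrightarrow> M $$ (u, v) = 0"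
    using M by (auto simp: graph_matrices_def pverts_G)
  define s where "s = - l / 7"
  have "s > 0" using \<open>l < 0\<close> by (simp add: s_def)
  define P where "P i j = M $$ (x i, x j) + s" for i j
  have minor: "P i k * P j m = P i m * P j k" if "i < 7" "j < 7" "k < 7" "m < 7" for i j k m
    using deflated_minor_zero[OF carrier sym eig _ large x_less[OF that(1)] x_less[OF that(2)]
        x_less[OF that(3)] x_less[OF that(4)]] \<open>l < 0\<close>
    by (simp add: P_def s_def)
  have P_sym: "P i j = P j i" if "i < 7" "j < 7" for i j
    using sym carrier x_less[OF that(1)] x_less[OF that(2)] unfolding P_def
    by (metis carrier_matD index_transpose_mat(1))
  have P_coadj: "P i j = s" if "i < 7" "j < 7" "coadjacent i j" for i j
    using nonadj[of "x i" "x j"] arc_iff[of i j] that x_less x_eq_iff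
    by (auto simp: P_def coadjacent_def)
  have row_sum: "(\<Sum>j\<in>{0..<7}. P 0 j) = 0"
  proof -
    have "(\<Sum>j\<in>{0..<7}. M $$ (x 0, x j)) = (\<Sum>v\<in>{0..<7}. M $$ (x 0, v))"
      by (rule sum.reindex_bij_betw[OF x_bij])
    also have "\<dots> = (M *\<^sub>v all_ones 7) $ x 0"
      using carrier x_less[of 0] by (simp add: scalar_prod_def all_ones_def)
    also have "\<dots> = l"
      unfolding eig using x_less[of 0] by (simp add: all_ones_def)
    finally show ?thesis
      by (simp add: P_def s_def sum_subtractf)
  qed
  have triangle: "P 0 1 = s" "P 0 2 = s" "P 1 2 = s" and star: "P 3 4 = s" "P 3 5 = s" "P 3 6 = s"
    by (auto intro!: P_coadj simp: coadjacent_def)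
  have "P 0 0 * P 1 2 = P 0 2 * P 1 0"
    by (rule minor) simp_all
  hence P00: "P 0 0 = s"
    using triangle P_sym[of 0 1] \<open>s > 0\<close> by simp
  have leaf: "P 0 5 = P 0 4" "P 0 6 = P 0 4"
    using minor[of 0 3 4 5] minor[of 0 3 4 6] star \<open>s > 0\<close> by auto
  have "P 0 0 * P 3 4 = P 0 4 * P 3 0"
    by (rule minor) simp_all
  hence pq: "P 0 4 * P 0 3 = s * s"
    using P00 star P_sym[of 0 3] by simp
  have "3 * s + P 0 3 + 3 * P 0 4 = 0"
    using row_sum P00 triangle leaf by (simp add: sum_less_7)
  hence "0 = P 0 4 * (3 * s + P 0 3 + 3 * P 0 4)"
    by simp
  also have "\<dots> = 3 * (P 0 4 + s / 2)\<^sup>2 + s\<^sup>2 / 4"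
    using pq by (simp add: power2_eq_square algebra_simps)
  also have "\<dots> > 0"
    using \<open>s > 0\<close> by (simp add: add_nonneg_pos)
  finally show False by simp
qed

definition witness :: "real mat" where
  "witness = mat 7 7 (\<lambda>(u, v). base_matrix $$ (position u, position v))"

lemma witness_carrier: "witness \<in> carrier_mat 7 7"
  by (simp add: witness_def)

lemma witness_jordan_nf: "jordan_nf witness (map (Pair 1) [-5, 3, 0, 0, 0, 0, 0])"
  using similar_mat_trans[OF similar_mat_reindex[OF _ position_bij]] base_matrix_jordan_nf base_matrix_carrier
  unfolding jordan_nf_def witness_def by blast

lemma witness_in_graph_matrices: "witness \<in> graph_matrices G"
proof -
  have "num_neg_eigenvalues witness = 1"
    by (rule base_matrix_spectrum(1)[OF witness_carrier witness_jordan_nf])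
  moreover have "transpose_mat witness = witness"
    by (intro eq_matI) (auto simp: witness_def base_matrix_def position_less mult.commute)
  moreover have "witness $$ (u, v) = (if (u, v) \<in> parcs G then -1 else 0)"
    if "u < 7" "v < 7" "u \<noteq> v" for u v
  proof -
    have "position u \<noteq> position v"
      using that x_position by metis
    thus ?thesis
      using that by (simp add: witness_def base_matrix_entry position_less arc_position)
  qed
  moreover have "u \<noteq> v" if "(u, v) \<in> parcs G" "u < 7" "v < 7" for u v
    using that by (simp add: arc_position)
  ultimately show ?thesis
    using witness_carrier by (auto simp: graph_matrices_def pverts_G)
qed

text \<open>
  A matrix \<open>X\<close> as in the property lives on the edges of the triangle and the star. Multiplying row \<open>0\<close>
  of the witness with a column of \<open>X\<close> at a leaf isolates the entry of \<open>X\<close> at the edge from the centre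
  to that leaf. Multiplying row \<open>4\<close> with the columns \<open>0, 1, 2\<close> shows that any two of the three
  triangle entries sum to zero, so all three vanish.
\<close>

lemma witness_sap: "strong_arnold_property G witness"
proof -
  have *: "X = 0\<^sub>m 7 7"
    if X: "X \<in> carrier_mat 7 7" "transpose_mat X = X" "witness * X = 0\<^sub>m 7 7"
      and supp: "\<And>u v. u < 7 \<Longrightarrow> v < 7 \<Longrightarrow> (u, v) \<in> parcs G \<or> u = v \<Longrightarrow> X $$ (u, v) = 0" for X
  proof -
    define Y where "Y i j = X $$ (x i, x j)" for i j
    have Y_sym: "Y i j = Y j i" if "i < 7" "j < 7" for i j
      using X(1,2) x_less[OF that(1)] x_less[OF that(2)] unfolding Y_def
      by (metis carrier_matD index_transpose_mat(1))
    have Y_supp: "Y i j = 0" if "i < 7" "j < 7" "\<not> coadjacent i j" for i j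
      using that supp[of "x i" "x j"] x_less arc_iff unfolding Y_def by metis
    have mult: "(\<Sum>k\<in>{0..<7}. base_matrix $$ (i, k) * Y k j) = 0" if "i < 7" "j < 7" for i j
    proof -
      have "0 = (witness * X) $$ (x i, x j)"
        using X(3) that x_less by simp
      also have "\<dots> = (\<Sum>v\<in>{0..<7}. witness $$ (x i, v) * X $$ (v, x j))"
        using witness_carrier X(1) that x_less by (simp add: scalar_prod_def)
      also have "\<dots> = (\<Sum>k\<in>{0..<7}. witness $$ (x i, x k) * X $$ (x k, x j))"
        by (rule sum.reindex_bij_betw[OF x_bij, symmetric])
      also have "\<dots> = (\<Sum>k\<in>{0..<7}. base_matrix $$ (i, k) * Y k j)"
        using that by (intro sum.cong refl) (simp add: witness_def Y_def x_less position_x)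
      finally show ?thesis by simp
    qed
    have triangle: "Y 0 1 = 0 \<and> Y 0 2 = 0 \<and> Y 1 2 = 0"
      using mult[of 4 0] mult[of 4 1] mult[of 4 2] Y_sym[of 0 1] Y_sym[of 0 2] Y_sym[of 1 2]
      by (simp add: sum_less_7 base_matrix_entry Y_supp coadjacent_def)
    have star: "Y 3 j = 0" if "j = 4 \<or> j = 5 \<or> j = 6" for j
      using mult[of 0 j] that by (auto simp: sum_less_7 base_matrix_entry Y_supp coadjacent_def)
    have Y0: "Y i j = 0" if "i < 7" "j < 7" for i j
    proof (cases "coadjacent i j")
      case True
      thus ?thesis
        using that triangle star[of 4] star[of 5] star[of 6] Y_sym[of i j]
        unfolding less_7_cases by (elim disjE; simp add: coadjacent_def)
    qed (use that Y_supp in blast)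
    show ?thesis
    proof (rule eq_matI)
      fix u v assume "u < dim_row (0\<^sub>m 7 7 :: real mat)" "v < dim_col (0\<^sub>m 7 7 :: real mat)"
      thus "X $$ (u, v) = 0\<^sub>m 7 7 $$ (u, v)"
        using Y0[of "position u" "position v"] by (simp add: Y_def position_less x_position)
    qed (use X(1) in auto)
  qed
  have "\<not> (\<exists>X\<in>carrier_mat 7 7. X \<noteq> 0\<^sub>m 7 7 \<and> transpose_mat X = X \<and> witness * X = 0\<^sub>m 7 7
      \<and> (\<forall>u\<in>{0..<7}. \<forall>v\<in>{0..<7}. (u, v) \<in> parcs G \<or> u = v \<longrightarrow> X $$ (u, v) = 0))"
    (is "\<not> (\<exists>X\<in>_. ?bad X)")
  proof (intro notI)
    assume "\<exists>X\<in>carrier_mat 7 7. ?bad X"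
    then obtain X where X: "X \<in> carrier_mat 7 7" "?bad X" ..
    hence "X $$ (u, v) = 0" if "u < 7" "v < 7" "(u, v) \<in> parcs G \<or> u = v" for u v
      using that by auto
    with X *[of X] show False by blast
  qed
  thus ?thesis
    by (simp add: strong_arnold_property_def pverts_G)
qed

text \<open>
  The coranks over which the maximum is taken are bounded by the number of vertices, and the witness
  attains \<open>5\<close>.
\<close>

lemma mu_ge_5: "5 \<le> cdv_mu G"
proof -
  let ?S = "{corank M | M. cdv_matrix G M}"
  have "?S \<subseteq> {..7}"
    using kernel_dim_le by (auto simp: cdv_matrix_def graph_matrices_def pverts_G)
  hence "finite ?S"
    using finite_subset by blast
  moreover have "5 \<in> ?S"
    using witness_in_graph_matrices witness_sap base_matrix_spectrum(2)[OF witness_carrier witness_jordan_nf]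
    by (auto simp: cdv_matrix_def intro!: exI[of _ witness])
  ultimately show ?thesis
    unfolding cdv_mu_def by (rule Max_ge)
qed

lemma no_optimal_all_ones:
  "\<not> (\<exists>M. cdv_matrix G M \<and> corank M = cdv_mu G \<and> perron_frobenius_eigenvector M (all_ones 7))"
proof
  assume "\<exists>M. cdv_matrix G M \<and> corank M = cdv_mu G \<and> perron_frobenius_eigenvector M (all_ones 7)"
  then obtain M l where M: "M \<in> graph_matrices G" "corank M = cdv_mu G"
    and eig: "eigenvector M (all_ones 7) l" and least: "\<And>k. eigenvalue M k \<Longrightarrow> l \<le> k"
    by (auto simp: cdv_matrix_def perron_frobenius_eigenvector_def)
  have "num_neg_eigenvalues M \<noteq> 0"
    using M(1) by (simp add: graph_matrices_def)
  then obtain k where "eigenvalue M k" "k < 0"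
    unfolding num_neg_eigenvalues_def by (metis (mono_tags, lifting) mem_Collect_eq sum.neutral)
  hence "l < 0"
    using least by fastforce
  moreover have "M *\<^sub>v all_ones 7 = l \<cdot>\<^sub>v all_ones 7"
    using eig by (simp add: eigenvector_def)
  ultimately show False
    using no_all_ones_eigenvector[OF M(1)] M(2) mu_ge_5 by fastforce
qed

end

lemma triangle_star_complementE:
  assumes G: "numbered_graph 7 G"
    and A: "K\<^bsub>3\<^esub> (with_proj A)" and B: "K\<^bsub>1,3\<^esub> (with_proj B)"
    and union: "disjoint_union_of (with_proj (complement_graph G)) (with_proj A) (with_proj B)"
  obtains x where "triangle_star_complement G x"
proof -
  have card_A: "card (pverts A) = 3"
    and arcs_A: "parcs A = {(u, v). u \<in> pverts A \<and> v \<in> pverts A \<and> u \<noteq> v}"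
    using A unfolding complete_digraph_pair_def by auto
  obtain U V where UV: "pverts B = U \<union> V" "U \<inter> V = {}" "card U = 1" "card V = 3"
    and arcs_B: "parcs B = U \<times> V \<union> V \<times> U"
    using B unfolding complete_bipartite_digraph_pair_def by blast
  obtain a b c where a: "pverts A = {a, b, c}" "a \<noteq> b" "a \<noteq> c" "b \<noteq> c"
    using card_A by (auto simp: card_3_iff)
  obtain d where d: "U = {d}"
    using UV(3) by (rule card_1_singletonE)
  obtain e f g where e: "V = {e, f, g}" "e \<noteq> f" "e \<noteq> g" "f \<noteq> g"
    using UV(4) by (auto simp: card_3_iff)
  have disj: "pverts A \<inter> pverts B = {}"
    and eq: "with_proj (complement_graph G) = Digraph_Component.union (with_proj A) (with_proj B)"
    using union by (simp_all add: disjoint_union_of_def)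
  have "pverts G = pverts A \<union> pverts B"
    using arg_cong[OF eq, of verts] by (simp add: Digraph_Component.union_def complement_graph_def)
  hence verts: "{0..<7} = {a, b, c, d, e, f, g}"
    using G UV(1) a(1) d e(1) by (simp add: numbered_graph_def insert_commute Un_commute)
  have "parcs (complement_graph G) = parcs A \<union> parcs B"
    using arg_cong[OF eq, of arcs] by (simp add: Digraph_Component.union_def)
  hence arcs: "(u, v) \<notin> parcs G \<and> u \<noteq> v \<longleftrightarrow> (u, v) \<in> parcs A \<union> parcs B" if "u < 7" "v < 7" for u v
    using G that by (auto simp: complement_graph_def numbered_graph_def set_eq_iff)
  define x where "x = (!) [a, b, c, d, e, f, g]"
  have distinct: "distinct [a, b, c, d, e, f, g]"
    using a d e UV disj by auto
  have bij: "bij_betw x {0..<7} {0..<7}"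
    unfolding x_def
  proof (rule bij_betw_nth[OF distinct])
    show "{0..<7} = {..<length [a, b, c, d, e, f, g]}"
      by (simp add: atLeast0LessThan)
    show "{0..<7} = set [a, b, c, d, e, f, g]"
      using verts by simp
  qed
  show thesis
  proof (rule that, unfold_locales)
    fix i j :: nat assume ij: "i < 7" "j < 7"
    hence x: "x i < 7" "x j < 7" using bij_betwE[OF bij] by auto
    have inj: "x k = x m \<longleftrightarrow> k = m" if "k < 7" "m < 7" for k m
      using bij_betw_imp_inj_on[OF bij] that by (auto dest: inj_onD)
    have names: "pverts A = {x 0, x 1, x 2}" "U = {x 3}" "V = {x 4, x 5, x 6}"
      unfolding a(1) d e(1) by (simp_all add: x_def)
    have "x k \<in> pverts A \<longleftrightarrow> k < 3" "x k \<in> U \<longleftrightarrow> k = 3" "x k \<in> V \<longleftrightarrow> 3 < k" if "k < 7" for k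
      using that unfolding names by (auto simp: inj)
    hence "(x i, x j) \<in> parcs A \<union> parcs B \<longleftrightarrow> coadjacent i j"
      using ij inj unfolding arcs_A arcs_B by (auto simp: coadjacent_def)
    moreover have "x i = x j \<longleftrightarrow> i = j"
      using ij by (rule inj)
    moreover have "(x i, x i) \<notin> parcs G"
    proof -
      interpret pair_graph G
        using G by (simp add: numbered_graph_def)
      show ?thesis
        using no_loops' by blast
    qed
    ultimately show "(x i, x j) \<in> parcs G \<longleftrightarrow> i \<noteq> j \<and> \<not> coadjacent i j"
      using arcs[OF x] by auto
  qed (fact G bij)+
qed

lemma triangle_star_complement_exists:
  obtains G A B where "numbered_graph 7 G" "K\<^bsub>3\<^esub> (with_proj A)" "K\<^bsub>1,3\<^esub> (with_proj B)"
    "disjoint_union_of (with_proj (complement_graph G)) (with_proj A) (with_proj B)"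
proof -
  define A :: "nat pair_pre_digraph"
    where "A = \<lparr>pverts = {0, 1, 2}, parcs = {(u, v). u \<in> {0, 1, 2} \<and> v \<in> {0, 1, 2} \<and> u \<noteq> v}\<rparr>"
  define B :: "nat pair_pre_digraph"
    where "B = \<lparr>pverts = {3} \<union> {4, 5, 6}, parcs = {3} \<times> {4, 5, 6} \<union> {4, 5, 6} \<times> {3}\<rparr>"
  define C where "C = \<lparr>pverts = {0..<7}, parcs = parcs A \<union> parcs B\<rparr>"
  define G where "G = complement_graph C"
  have G_arcs: "parcs G \<subseteq> {0..<7} \<times> {0..<7}"
    by (auto simp: G_def complement_graph_def C_def)
  have "pair_graph G"
  proof unfold_locales
    show "finite (parcs G)"
      using G_arcs by (rule finite_subset) simp
    show "symmetric (with_proj G)"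
      by (auto simp: symmetric_def sym_def G_def C_def A_def B_def complement_graph_def)
  qed (auto simp: G_def C_def complement_graph_def)
  hence 1: "numbered_graph 7 G"
    by (simp add: numbered_graph_def G_def complement_graph_def C_def)
  have 2: "K\<^bsub>3\<^esub> (with_proj A)"
    unfolding complete_digraph_pair_def by (auto simp: A_def)
  have 3: "K\<^bsub>1,3\<^esub> (with_proj B)"
    unfolding complete_bipartite_digraph_pair_def
    by (intro conjI exI[of _ "{3}"] exI[of _ "{4, 5, 6}"]) (auto simp: B_def)
  have "complement_graph G = C"
    by (auto simp: G_def C_def complement_graph_def A_def B_def)
  moreover have "{0..<7} = {0, 1, 2} \<union> ({3} \<union> {4, 5, 6 :: nat})"
    by (auto simp: less_7_cases)
  ultimately have 4: "disjoint_union_of (with_proj (complement_graph G)) (with_proj A) (with_proj B)"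
    by (auto simp: disjoint_union_of_def Digraph_Component.union_def with_proj_def A_def B_def C_def)
  show thesis
    by (rule that[OF 1 2 3 4])
qed

theorem mainTheorem2:
  shows "(\<forall>(G :: nat pair_pre_digraph) (A :: nat pair_pre_digraph) (B :: nat pair_pre_digraph).
            numbered_graph 7 G
            \<and> K\<^bsub>3\<^esub> (with_proj A) \<and> K\<^bsub>1,3\<^esub> (with_proj B)
            \<and> disjoint_union_of (with_proj (complement_graph G)) (with_proj A) (with_proj B)
            \<longrightarrow> connected (with_proj G)
              \<and> \<not> (\<exists>M. cdv_matrix G M \<and> corank M = cdv_mu G
                     \<and> perron_frobenius_eigenvector M (all_ones 7)))
       \<and> \<not> (\<forall>(n :: nat) (H :: nat pair_pre_digraph).
               numbered_graph n H \<and> connected (with_proj H) \<longrightarrow>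
               (\<exists>M. cdv_matrix H M \<and> corank M = cdv_mu H
                  \<and> perron_frobenius_eigenvector M (all_ones n)))"
proof -
  have first: "connected (with_proj G)
      \<and> \<not> (\<exists>M. cdv_matrix G M \<and> corank M = cdv_mu G \<and> perron_frobenius_eigenvector M (all_ones 7))"
    if G: "numbered_graph 7 G" "K\<^bsub>3\<^esub> (with_proj A)" "K\<^bsub>1,3\<^esub> (with_proj B)"
      "disjoint_union_of (with_proj (complement_graph G)) (with_proj A) (with_proj B)"
    for G A B :: "nat pair_pre_digraph"
  proof -
    obtain x where "triangle_star_complement G x"
      by (rule triangle_star_complementE[OF G])
    thus ?thesis
      using triangle_star_complement.connected_G triangle_star_complement.no_optimal_all_ones by blast
  qed
  obtain G A B where "numbered_graph 7 G" "K\<^bsub>3\<^esub> (with_proj A)" "K\<^bsub>1,3\<^esub> (with_proj B)"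
    "disjoint_union_of (with_proj (complement_graph G)) (with_proj A) (with_proj B)"
    by (rule triangle_star_complement_exists)
  from first[OF this] this(1) first show ?thesis
    by blast
qed

end
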